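(* Let $\mathbb F_q$ be a finite field and let $A$ be an upper triangular $n\times n$ matrix over $\mathbb F_q$. If $A$ admits a Cholesky root, i.e. if there is an upper triangular $n\times n$ matrix $U$ over $\mathbb F_q$ with $U^TU=A$, then $A$ is diagonal. *)

theory Defs
  imports "Jordan_Normal_Form.Matrix"
begin

text \<open>No conjugation and no condition on the diagonal of \<open>U\<close> is involved: positivity has no
  meaning over a finite field, so neither uniqueness nor invertibility of \<open>U\<close> is required.\<close>

definition cholesky_root :: "nat \<Rightarrow> 'a :: field mat \<Rightarrow> 'a mat \<Rightarrow> bool" where
  "cholesky_root n A U \<longleftrightarrow>
     U \<in> carrier_mat n n \<and> upper_triangular U \<and> transpose_mat U * U = A"

definition admits_cholesky_root :: "nat \<Rightarrow> 'a :: field mat \<Rightarrow> bool" where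
  "admits_cholesky_root n A \<longleftrightarrow> (\<exists>U. cholesky_root n A U)"

end

theory Submission
  imports Defs
begin

text \<open>A Gram matrix \<open>U\<^sup>T U\<close> is symmetric, and symmetry carries the zeros
  below the diagonal of a triangular matrix to the positions above it.\<close>

lemma transpose_gram_mat:
  fixes U :: "'a :: comm_semiring_0 mat"
  shows "transpose_mat (transpose_mat U * U) = transpose_mat U * U"
  by (subst transpose_mult[where nr = "dim_col U" and n = "dim_row U" and nc = "dim_col U"])
    auto

lemma diagonal_mat_if_symmetric_upper_triangular:
  assumes A: "A \<in> carrier_mat n n" and sym: "transpose_mat A = A" and tri: "upper_triangular A"
  shows "diagonal_mat A"
  unfolding diagonal_mat_def
proof (intro allI impI)
  fix i j assume i: "i < dim_row A" and j: "j < dim_col A" and "i \<noteq> j"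
  then consider "j < i" | "i < j" by linarith
  then show "A $$ (i, j) = 0"
  proof cases
    case 1
    then show ?thesis using tri i by auto
  next
    case 2
    have "A $$ (i, j) = transpose_mat A $$ (i, j)" using sym by simp
    also have "\<dots> = A $$ (j, i)" using A i j by simp
    also have "\<dots> = 0" using tri A j 2 by auto
    finally show ?thesis .
  qed
qed

theorem proposition4p1:
  fixes A :: "'q :: {field, finite} mat" and n :: nat
  assumes "A \<in> carrier_mat n n"
    and "upper_triangular A"
    and "admits_cholesky_root n A"
  shows "diagonal_mat A"
proof -
  obtain U where "transpose_mat U * U = A"
    using assms(3) unfolding admits_cholesky_root_def cholesky_root_def by blast
  then have "transpose_mat A = A"
    using transpose_gram_mat by blast
  then show ?thesis
    using diagonal_mat_if_symmetric_upper_triangular assms(1,2) by blast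
qed

end
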